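(* Let $X$ be a real random variable with finite law $x_1<\cdots<x_n$, $p_i=\mathbb P(X=x_i)>0$, $\sum_{i=1}^n p_i=1$, $n\ge 2$, and let $W_i,B_i$ $(0\le i\le n)$ and $L_i,R_i$ $(1\le i\le n)$ be the quantities defined in the context. Then for every $1\le i\le n$, $$W_i-W_{i-1}=p_i\,(L_i^2-R_i^2),\qquad B_i-B_{i-1}=p_i\,(R_i^2-L_i^2).$$ Consequently, moving $x_i$ from the right regime to the left regime weakly lowers the optimized risk (that is, $W_i\le W_{i-1}$) exactly when $R_i\ge L_i$. (At $i=1$ and $i=n$ the identity compares a two-regime cut with the one-regime endpoint; only the interior indices compare two nonempty adjacent splits.)
   Context: Put $P_i:=\sum_{j\le i}p_j$, $P_0:=0$, and $T_i:=\sum_{j\ge i}p_j=1-P_{i-1}$. For $1\le i<n$ the optimized squared risk at the cut after $x_i$ is $$W_i:=\min_{a,b\in\mathbb R}\Big\{\sum_{j\le i}p_j(x_j-a)^2+\sum_{j>i}p_j(x_j-b)^2\Big\}.$$ Also $W_0=W_n:=\operatorname{Var}(X)$ and $B_i:=\operatorname{Var}(X)-W_i$ for $0\le i\le n$ (so $B_0=B_n=0$). For $1\le i<n$ set $A_i:=\sum_{j>i}p_j(x_j-x_i)$ and $R_i:=A_i/\sqrt{T_iT_{i+1}}$; for $1<i\le n$ set $C_i:=\sum_{j<i}p_j(x_i-x_j)$ and $L_i:=C_i/\sqrt{P_{i-1}P_i}$; and $L_1:=0$, $R_n:=0$. *)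

theory Defs
  imports "HOL-Probability.Probability"
begin

text \<open>
  The atoms and weights are functions on naturals, of which only the values at \<open>1, \<dots>, n\<close> matter.
\<close>

definition lower_mass :: "(nat \<Rightarrow> real) \<Rightarrow> nat \<Rightarrow> real" where
  "lower_mass p i = (\<Sum>j=1..i. p j)"

definition upper_mass :: "nat \<Rightarrow> (nat \<Rightarrow> real) \<Rightarrow> nat \<Rightarrow> real" where
  "upper_mass n p i = (\<Sum>j=i..n. p j)"

definition split_risk ::
  "nat \<Rightarrow> (nat \<Rightarrow> real) \<Rightarrow> (nat \<Rightarrow> real) \<Rightarrow> nat \<Rightarrow> real \<Rightarrow> real \<Rightarrow> real" where
  "split_risk n x p i a b =
     (\<Sum>j=1..i. p j * (x j - a)\<^sup>2) + (\<Sum>j=Suc i..n. p j * (x j - b)\<^sup>2)"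

text \<open>
  At an interior cut, \<open>LEAST\<close> is the attained minimum over both regime values (not merely an
  infimum). At \<open>i = 0\<close> and \<open>i = n\<close> the value is by convention the variance of \<open>X\<close>.
\<close>

definition opt_risk ::
  "'a measure \<Rightarrow> ('a \<Rightarrow> real) \<Rightarrow> nat \<Rightarrow> (nat \<Rightarrow> real) \<Rightarrow> (nat \<Rightarrow> real) \<Rightarrow> nat \<Rightarrow> real" where
  "opt_risk M X n x p i =
     (if i = 0 \<or> i = n then prob_space.variance M X
      else (LEAST w. \<exists>a b. w = split_risk n x p i a b))"

definition risk_gain ::
  "'a measure \<Rightarrow> ('a \<Rightarrow> real) \<Rightarrow> nat \<Rightarrow> (nat \<Rightarrow> real) \<Rightarrow> (nat \<Rightarrow> real) \<Rightarrow> nat \<Rightarrow> real" where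
  "risk_gain M X n x p i = prob_space.variance M X - opt_risk M X n x p i"

definition right_excess :: "nat \<Rightarrow> (nat \<Rightarrow> real) \<Rightarrow> (nat \<Rightarrow> real) \<Rightarrow> nat \<Rightarrow> real" where
  "right_excess n x p i = (\<Sum>j=Suc i..n. p j * (x j - x i))"

definition left_excess :: "(nat \<Rightarrow> real) \<Rightarrow> (nat \<Rightarrow> real) \<Rightarrow> nat \<Rightarrow> real" where
  "left_excess x p i = (\<Sum>j=1..<i. p j * (x i - x j))"

definition right_pull :: "nat \<Rightarrow> (nat \<Rightarrow> real) \<Rightarrow> (nat \<Rightarrow> real) \<Rightarrow> nat \<Rightarrow> real" where
  "right_pull n x p i =
     (if i = n then 0
      else right_excess n x p i / sqrt (upper_mass n p i * upper_mass n p (i + 1)))"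

definition left_pull :: "(nat \<Rightarrow> real) \<Rightarrow> (nat \<Rightarrow> real) \<Rightarrow> nat \<Rightarrow> real" where
  "left_pull x p i =
     (if i = 1 then 0
      else left_excess x p i / sqrt (lower_mass p (i - 1) * lower_mass p i))"

end

theory Submission
  imports Defs
begin

text \<open>
  The optimized risk of a cut is the sum of the centred second moments of its two blocks; with the
  convention \<open>0 / 0 = 0\<close> this also holds at the endpoints, where one block is empty. Moving \<open>x\<^sub>i\<close>
  deletes one point from a block and adds it to the other. By Welford's update formula, adding a
  point \<open>x\<^sub>k\<close> to a block of mass \<open>P\<close> raises the block's centred second moment by
  \<open>p\<^sub>k (\<Sum>\<^sub>j p\<^sub>j (x\<^sub>k - x\<^sub>j))\<^sup>2 / (P (P + p\<^sub>k))\<close>, which is \<open>p\<^sub>k\<close> times a squared pull.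
\<close>

definition block_scatter :: "('i \<Rightarrow> real) \<Rightarrow> ('i \<Rightarrow> real) \<Rightarrow> 'i set \<Rightarrow> real" where
  "block_scatter p x S =
     (\<Sum>j\<in>S. p j * (x j)\<^sup>2) - (\<Sum>j\<in>S. p j * x j)\<^sup>2 / (\<Sum>j\<in>S. p j)"

lemma sum_weighted_square_expand:
  fixes p x :: "'i \<Rightarrow> real"
  shows "(\<Sum>j\<in>S. p j * (x j - a)\<^sup>2) =
    (\<Sum>j\<in>S. p j * (x j)\<^sup>2) - 2 * a * (\<Sum>j\<in>S. p j * x j) + a\<^sup>2 * (\<Sum>j\<in>S. p j)"
proof -
  have "(\<Sum>j\<in>S. p j * (x j - a)\<^sup>2) =
      (\<Sum>j\<in>S. p j * (x j)\<^sup>2 - 2 * a * (p j * x j) + a\<^sup>2 * p j)"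
    by (intro sum.cong refl) (simp add: power2_eq_square algebra_simps)
  then show ?thesis
    by (simp add: sum.distrib sum_subtractf sum_distrib_left)
qed

text \<open>Completing the square in \<open>a\<close>: the last term vanishes at the weighted mean,
  so \<open>block_scatter\<close> is the second moment centred there and, for positive mass, the
  minimum over \<open>a\<close>. Both the variance and the risk of a cut are read off from
  this.\<close>

lemma sum_weighted_square_eq_scatter:
  fixes p x :: "'i \<Rightarrow> real"
  assumes "(\<Sum>j\<in>S. p j) \<noteq> 0"
  shows "(\<Sum>j\<in>S. p j * (x j - a)\<^sup>2) =
    block_scatter p x S + (\<Sum>j\<in>S. p j) * (a - (\<Sum>j\<in>S. p j * x j) / (\<Sum>j\<in>S. p j))\<^sup>2"
  unfolding sum_weighted_square_expand block_scatter_def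
  using assms by (simp add: field_simps power2_eq_square)

lemma block_scatter_insert:
  fixes p x :: "'i \<Rightarrow> real"
  assumes "finite S" "k \<notin> S" and pos: "\<And>j. j \<in> insert k S \<Longrightarrow> p j > 0"
  shows "block_scatter p x (insert k S) = block_scatter p x S +
    p k * (\<Sum>j\<in>S. p j * (x k - x j))\<^sup>2 / ((\<Sum>j\<in>S. p j) * (\<Sum>j\<in>insert k S. p j))"
proof (cases "S = {}")
  case True
  \<comment> \<open>A single point has scatter 0, and the correction term is an empty sum squared
    over 0, hence also 0.\<close>
  then show ?thesis
    by (simp add: block_scatter_def power2_eq_square)
next
  case False
  define P where "P = (\<Sum>j\<in>S. p j)"
  define E where "E = (\<Sum>j\<in>S. p j * x j)"
  define Q where "Q = (\<Sum>j\<in>S. p j * (x j)\<^sup>2)"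
  have P: "P > 0"
    unfolding P_def using False assms by (intro sum_pos) auto
  then have sum: "p k + P > 0"
    using pos[of k] by simp
  have excess: "(\<Sum>j\<in>S. p j * (x k - x j)) = x k * P - E"
    by (simp add: P_def E_def sum_subtractf sum_distrib_left algebra_simps)
  \<comment> \<open>Only the mass \<open>P\<close> and the moments \<open>E\<close> and
    \<open>Q\<close> of the old block matter; clearing the nonzero denominators leaves a polynomial
    identity.\<close>
  have "p k * (x k)\<^sup>2 + Q - (p k * x k + E)\<^sup>2 / (p k + P) =
      Q - E\<^sup>2 / P + p k * (x k * P - E)\<^sup>2 / (P * (p k + P))"
    using P sum by (simp add: divide_simps) (simp add: power2_eq_square algebra_simps)
  then show ?thesis
    using assms(1,2) by (simp add: block_scatter_def excess flip: P_def E_def Q_def)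
qed

text \<open>The events \<open>X = x j\<close> are disjoint by injectivity and their probabilities
  sum to 1, so they cover the space almost surely and \<open>f (X \<omega>)\<close> is almost surely
  a simple function. General \<open>f\<close> is kept because the variance needs both the identity
  and a squared deviation.\<close>

lemma (in prob_space) expectation_finite_law:
  fixes X :: "'a \<Rightarrow> real" and f :: "real \<Rightarrow> real"
  assumes meas: "X \<in> borel_measurable M" and "finite J" and inj: "inj_on x J"
    and p: "\<And>j. j \<in> J \<Longrightarrow> p j = prob {\<omega> \<in> space M. X \<omega> = x j}"
    and total: "(\<Sum>j\<in>J. p j) = 1" and [measurable]: "f \<in> borel_measurable borel"
  shows "expectation (\<lambda>\<omega>. f (X \<omega>)) = (\<Sum>j\<in>J. p j * f (x j))"
proof -
  note meas [measurable]
  define A where "A j = {\<omega> \<in> space M. X \<omega> = x j}" for j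
  have [measurable]: "A j \<in> sets M" for j
    unfolding A_def by measurable
  have disj: "disjoint_family_on A J"
    using inj by (auto simp: disjoint_family_on_def A_def inj_on_def)
  have "prob (\<Union>j\<in>J. A j) = (\<Sum>j\<in>J. prob (A j))"
    using \<open>finite J\<close> disj by (intro finite_measure_finite_Union) auto
  also have "\<dots> = 1"
    using p total by (simp add: A_def)
  finally have "AE \<omega> in M. \<omega> \<in> (\<Union>j\<in>J. A j)"
    using \<open>finite J\<close> by (subst (asm) prob_eq_1) auto
  then have "AE \<omega> in M. f (X \<omega>) = (\<Sum>j\<in>J. f (x j) * indicator (A j) \<omega>)"
  proof eventually_elim
    case (elim \<omega>)
    then obtain k where k: "k \<in> J" "\<omega> \<in> A k"
      by auto
    \<comment> \<open>Disjointness leaves exactly one nonzero indicator at \<open>\<omega>\<close>,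
      so the sum collapses to its \<open>k\<close>-th term.\<close>
    have "indicator (A j) \<omega> = (if j = k then 1 else 0 :: real)" if "j \<in> J" for j
      using k that disj by (auto simp: disjoint_family_on_def indicator_def)
    then have "(\<Sum>j\<in>J. f (x j) * indicator (A j) \<omega>) = (\<Sum>j\<in>J. if j = k then f (x j) else 0)"
      by (intro sum.cong) auto
    then show ?case
      using k \<open>finite J\<close> by (simp add: A_def)
  qed
  then have "expectation (\<lambda>\<omega>. f (X \<omega>)) = expectation (\<lambda>\<omega>. \<Sum>j\<in>J. f (x j) * indicator (A j) \<omega>)"
    by (intro integral_cong_AE) auto
  also have "\<dots> = (\<Sum>j\<in>J. f (x j) * prob (A j))"
    by (subst Bochner_Integration.integral_sum) (auto simp: integrable_real_indicator emeasure_eq_measure)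
  also have "\<dots> = (\<Sum>j\<in>J. p j * f (x j))"
    using p by (intro sum.cong) (auto simp: A_def)
  finally show ?thesis .
qed

text \<open>With total mass 1 the expectation is the weighted mean of the block \<open>J\<close>, so
  the square completed around it contributes nothing.\<close>

lemma (in prob_space) variance_finite_law:
  fixes X :: "'a \<Rightarrow> real"
  assumes "X \<in> borel_measurable M" "finite J" "inj_on x J"
    and "\<And>j. j \<in> J \<Longrightarrow> p j = prob {\<omega> \<in> space M. X \<omega> = x j}"
    and total: "(\<Sum>j\<in>J. p j) = 1"
  shows "variance X = block_scatter p x J"
proof -
  note law = expectation_finite_law[OF assms]
  have mean: "expectation X = (\<Sum>j\<in>J. p j * x j)"
    using law[of "\<lambda>t. t"] by simp
  have "variance X = (\<Sum>j\<in>J. p j * (x j - expectation X)\<^sup>2)"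
    by (rule law) measurable
  then show ?thesis
    using total by (simp add: sum_weighted_square_eq_scatter mean)
qed

text \<open>Each regime value enters only one of the two completed squares, so the two minimizations
  are independent. At an interior cut both blocks have positive mass.\<close>

lemma Least_split_risk:
  assumes "0 < i" "i < n" and pos: "\<And>j. j \<in> {1..n} \<Longrightarrow> p j > 0"
  shows "(LEAST w. \<exists>a b. w = split_risk n x p i a b) =
    block_scatter p x {1..i} + block_scatter p x {Suc i..n}"
proof -
  have lower: "(\<Sum>j=1..i. p j) > 0"
    using assms by (intro sum_pos) auto
  have upper: "(\<Sum>j=Suc i..n. p j) > 0"
    using assms by (intro sum_pos) auto
  have risk: "split_risk n x p i a b =
      (block_scatter p x {1..i} + (\<Sum>j=1..i. p j) * (a - (\<Sum>j=1..i. p j * x j) / (\<Sum>j=1..i. p j))\<^sup>2) +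
      (block_scatter p x {Suc i..n} +
        (\<Sum>j=Suc i..n. p j) * (b - (\<Sum>j=Suc i..n. p j * x j) / (\<Sum>j=Suc i..n. p j))\<^sup>2)" for a b
    unfolding split_risk_def using lower upper
    by (intro arg_cong2[of _ _ _ _ "(+)"] sum_weighted_square_eq_scatter) auto
  show ?thesis
  proof (rule Least_equality)
    show "\<exists>a b. block_scatter p x {1..i} + block_scatter p x {Suc i..n} = split_risk n x p i a b"
      \<comment> \<open>The minimum is attained at the two block means, where both squares
        vanish.\<close>
      by (intro exI[of _ "(\<Sum>j=1..i. p j * x j) / (\<Sum>j=1..i. p j)"]
          exI[of _ "(\<Sum>j=Suc i..n. p j * x j) / (\<Sum>j=Suc i..n. p j)"]) (simp add: risk)
  next
    fix w assume "\<exists>a b. w = split_risk n x p i a b"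
    then show "block_scatter p x {1..i} + block_scatter p x {Suc i..n} \<le> w"
      using lower upper by (auto simp: risk intro!: add_mono)
  qed
qed

lemma lower_mass_nonneg: "(\<And>j. j \<in> {1..i} \<Longrightarrow> p j \<ge> 0) \<Longrightarrow> lower_mass p i \<ge> 0"
  unfolding lower_mass_def by (rule sum_nonneg)

lemma upper_mass_nonneg: "(\<And>j. j \<in> {i..n} \<Longrightarrow> p j \<ge> 0) \<Longrightarrow> upper_mass n p i \<ge> 0"
  unfolding upper_mass_def by (rule sum_nonneg)

text \<open>Nonnegative masses let the square cancel the root. At \<open>i = 1\<close> the excess is
  an empty sum, so the formula agrees with the default value 0 and later steps need no case
  split.\<close>

lemma left_pull_square:
  assumes "i \<in> {1..n}" and pos: "\<And>j. j \<in> {1..n} \<Longrightarrow> p j > 0"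
  shows "(left_pull x p i)\<^sup>2 = (left_excess x p i)\<^sup>2 / (lower_mass p (i - 1) * lower_mass p i)"
proof -
  have "lower_mass p (i - 1) \<ge> 0" "lower_mass p i \<ge> 0"
    using assms by (auto simp: less_imp_le intro!: lower_mass_nonneg)
  then show ?thesis
    by (simp add: left_pull_def power_divide left_excess_def)
qed

lemma right_pull_square:
  assumes "i \<in> {1..n}" and pos: "\<And>j. j \<in> {1..n} \<Longrightarrow> p j > 0"
  shows "(right_pull n x p i)\<^sup>2 =
    (right_excess n x p i)\<^sup>2 / (upper_mass n p i * upper_mass n p (i + 1))"
proof -
  have "upper_mass n p i \<ge> 0" "upper_mass n p (i + 1) \<ge> 0"
    using assms by (auto simp: less_imp_le intro!: upper_mass_nonneg)
  then show ?thesis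
    by (simp add: right_pull_def power_divide right_excess_def)
qed

text \<open>The ordering of the atoms makes every summand of the excess nonnegative. The sign is
  needed to pass from comparing squared pulls to comparing pulls.\<close>

lemma left_pull_nonneg:
  assumes "strict_mono_on {1..n} x" "i \<in> {1..n}" "\<And>j. j \<in> {1..n} \<Longrightarrow> p j > 0"
  shows "left_pull x p i \<ge> 0"
proof -
  have "left_excess x p i \<ge> 0" "lower_mass p (i - 1) \<ge> 0" "lower_mass p i \<ge> 0"
    using assms unfolding left_excess_def
    by (auto simp: less_imp_le strict_mono_on_less_eq
        intro!: sum_nonneg mult_nonneg_nonneg lower_mass_nonneg)
  then show ?thesis
    by (simp add: left_pull_def)
qed

lemma right_pull_nonneg:
  assumes "strict_mono_on {1..n} x" "i \<in> {1..n}" "\<And>j. j \<in> {1..n} \<Longrightarrow> p j > 0"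
  shows "right_pull n x p i \<ge> 0"
proof -
  have "right_excess n x p i \<ge> 0" "upper_mass n p i \<ge> 0" "upper_mass n p (i + 1) \<ge> 0"
    using assms unfolding right_excess_def
    by (auto simp: less_imp_le strict_mono_on_less_eq
        intro!: sum_nonneg mult_nonneg_nonneg upper_mass_nonneg)
  then show ?thesis
    by (simp add: right_pull_def)
qed

text \<open>The old and new masses in the update formula are \<open>lower_mass p (i - 1)\<close> and
  \<open>lower_mass p i\<close>, exactly the product under the root in
  \<open>left_pull\<close>.\<close>

lemma block_scatter_lower_step:
  assumes i: "i \<in> {1..n}" and pos: "\<And>j. j \<in> {1..n} \<Longrightarrow> p j > 0"
  shows "block_scatter p x {1..i} = block_scatter p x {1..i - 1} + p i * (left_pull x p i)\<^sup>2"
proof -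
  have ins: "insert i {1..i - 1} = {1..i}" and excl: "{1..<i} = {1..i - 1}"
    using i by auto
  have "block_scatter p x (insert i {1..i - 1}) = block_scatter p x {1..i - 1} +
      p i * (left_excess x p i)\<^sup>2 / (lower_mass p (i - 1) * (\<Sum>j\<in>insert i {1..i - 1}. p j))"
    unfolding left_excess_def lower_mass_def excl
    using i by (intro block_scatter_insert pos) auto
  then show ?thesis
    unfolding ins using left_pull_square[OF i pos] by (simp add: lower_mass_def)
qed

lemma block_scatter_upper_step:
  assumes i: "i \<in> {1..n}" and pos: "\<And>j. j \<in> {1..n} \<Longrightarrow> p j > 0"
  shows "block_scatter p x {i..n} = block_scatter p x {Suc i..n} + p i * (right_pull n x p i)\<^sup>2"
proof -
  have ins: "insert i {Suc i..n} = {i..n}"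
    using i by auto
  \<comment> \<open>The update formula measures from the new point, the excess towards it; the
    opposite sign disappears on squaring.\<close>
  have "(\<Sum>j=Suc i..n. p j * (x i - x j)) = - right_excess n x p i"
    by (simp add: right_excess_def right_diff_distrib flip: sum_negf)
  moreover have "block_scatter p x (insert i {Suc i..n}) = block_scatter p x {Suc i..n} +
      p i * (\<Sum>j=Suc i..n. p j * (x i - x j))\<^sup>2 /
        ((\<Sum>j=Suc i..n. p j) * (\<Sum>j\<in>insert i {Suc i..n}. p j))"
    using i by (intro block_scatter_insert pos) auto
  ultimately show ?thesis
    unfolding ins using right_pull_square[OF i pos] by (simp add: upper_mass_def mult.commute)
qed

theorem proposition2p1:
  fixes M :: "'a measure" and X :: "'a \<Rightarrow> real"
    and n :: nat and x p :: "nat \<Rightarrow> real"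
  assumes "prob_space M"
    and "X \<in> borel_measurable M"
    and "n \<ge> 2"
    and "strict_mono_on {1..n} x"
    and "\<And>i. i \<in> {1..n} \<Longrightarrow> p i = measure M {\<omega> \<in> space M. X \<omega> = x i}"
    and "\<And>i. i \<in> {1..n} \<Longrightarrow> p i > 0"
    and "(\<Sum>i=1..n. p i) = 1"
  shows "\<forall>i\<in>{1..n}.
      opt_risk M X n x p i - opt_risk M X n x p (i - 1)
        = p i * ((left_pull x p i)\<^sup>2 - (right_pull n x p i)\<^sup>2) \<and>
      risk_gain M X n x p i - risk_gain M X n x p (i - 1)
        = p i * ((right_pull n x p i)\<^sup>2 - (left_pull x p i)\<^sup>2) \<and>
      (opt_risk M X n x p i \<le> opt_risk M X n x p (i - 1)
        \<longleftrightarrow> right_pull n x p i \<ge> left_pull x p i)"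
proof
  fix i assume i: "i \<in> {1..n}"
  have var: "prob_space.variance M X = block_scatter p x {1..n}"
    using assms by (intro prob_space.variance_finite_law strict_mono_on_imp_inj_on) auto
  have risk: "opt_risk M X n x p k = block_scatter p x {1..k} + block_scatter p x {Suc k..n}"
    if "k \<le> n" for k
  proof (cases "k = 0 \<or> k = n")
    \<comment> \<open>At either endpoint one block is empty with scatter 0, and the other is all of
      \<open>{1..n}\<close>, whose scatter is the variance.\<close>
    case True
    then show ?thesis
      by (auto simp: opt_risk_def var block_scatter_def)
  next
    case False
    then show ?thesis
      using that Least_split_risk[where p = p and i = k, OF _ _ assms(6)] by (auto simp: opt_risk_def)
  qed
  have diff: "opt_risk M X n x p i - opt_risk M X n x p (i - 1) =
      p i * ((left_pull x p i)\<^sup>2 - (right_pull n x p i)\<^sup>2)"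
  proof -
    \<comment> \<open>The right block of the cut at \<open>i - 1\<close> thus starts at
      \<open>i\<close>. Passing to the cut at \<open>i\<close>, the left block gains
      \<open>x i\<close> and the right block loses it, so the two one-point steps enter with
      opposite signs.\<close>
    have "Suc (i - 1) = i" "i \<le> n" "i - 1 \<le> n"
      using i by auto
    with risk[of i] risk[of "i - 1"] show ?thesis
      using block_scatter_lower_step[where p = p and x = x, OF i assms(6)]
        block_scatter_upper_step[where p = p and x = x, OF i assms(6)]
      by (simp add: algebra_simps)
  qed
  have "opt_risk M X n x p i \<le> opt_risk M X n x p (i - 1) \<longleftrightarrow>
      p i * ((left_pull x p i)\<^sup>2 - (right_pull n x p i)\<^sup>2) \<le> 0"
    using diff by linarith
  also have "\<dots> \<longleftrightarrow> (left_pull x p i)\<^sup>2 \<le> (right_pull n x p i)\<^sup>2"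
    using assms(6)[OF i] by (simp add: mult_le_0_iff)
  \<comment> \<open>Squaring is monotone on nonnegative reals, and both pulls are
    nonnegative.\<close>
  also have "\<dots> \<longleftrightarrow> left_pull x p i \<le> right_pull n x p i"
    using left_pull_nonneg[OF assms(4) i assms(6)] right_pull_nonneg[OF assms(4) i assms(6)]
    by (simp add: abs_le_square_iff[symmetric])
  finally have "opt_risk M X n x p i \<le> opt_risk M X n x p (i - 1) \<longleftrightarrow>
      left_pull x p i \<le> right_pull n x p i" .
  \<comment> \<open>In the difference of gains the variance cancels, leaving the negated difference
    of risks.\<close>
  with diff show "opt_risk M X n x p i - opt_risk M X n x p (i - 1)
        = p i * ((left_pull x p i)\<^sup>2 - (right_pull n x p i)\<^sup>2) \<and>
      risk_gain M X n x p i - risk_gain M X n x p (i - 1)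
        = p i * ((right_pull n x p i)\<^sup>2 - (left_pull x p i)\<^sup>2) \<and>
      (opt_risk M X n x p i \<le> opt_risk M X n x p (i - 1)
        \<longleftrightarrow> right_pull n x p i \<ge> left_pull x p i)"
    by (simp add: risk_gain_def algebra_simps)
qed

end
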